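(* Let $n\ge 2$ and let $\Lambda$ be the preprojective algebra of type $A_{n-1}$. Let $A=\{a_1<\dots<a_i\}$ and $B=\{b_1<\dots<b_j\}$ be proper subsets of $\{1,\dots,n\}$ of sizes $i$ and $j$ respectively, with $A\neq\{1,\dots,i\}$ and $B\ne\{1,\dots,j\}$. Then $$\dim\operatorname{Hom}_\Lambda(N(A),N(B))=\#\bigl\{r\in\{1,\dots,i\}: r\le j<a_r \text{ and } a_{r-l}\le b_{j-l}\text{ for all } l=0,\dots,r-1\bigr\},$$ where $N(A)$, $N(B)$ are the Maya modules.
   Context: Fix a ground field. Let $I=\{1,\dots,n-1\}$. A (finite-dimensional) $\Lambda$-module is an $I$-graded finite-dimensional vector space $M=\bigoplus_{i\in I}M_i$ with linear maps $(i\to i+1):M_i\to M_{i+1}$ (for $1\le i\le n-2$) and $(i\to i-1):M_i\to M_{i-1}$ (for $2\le i\le n-1$) satisfying, for every $i\in I$, $$(i+1\to i)\circ(i\to i+1)=(i-1\to i)\circ(i\to i-1)\quad\text{on } M_i,$$ with the convention $M_0=M_n=0$, so that $(1\to 0)$ and $(n-1\to n)$ are zero. Homomorphisms are graded linear maps commuting with all these maps. Maya modules: let $A=\{a_1<\dots<a_i\}$ be a proper subset of $\{1,\dots,n\}$ of size $i$ with $A\ne\{1,\dots,i\}$. $N(A)$ has basis $\{w_{j,k}: 1\le k\le i,\ k\le j\le a_k-1\}$ with $w_{j,k}\in N(A)_j$, and $$(j\to j-1)(w_{j,k})=w_{j-1,k},\qquad (j\to j+1)(w_{j,k})=w_{j+1,k+1},$$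 where $w_{j,k}$ is interpreted as $0$ whenever $(j,k)$ is not in the index set of the basis. *)

theory Defs
  imports Complex_Main "HOL-Library.Function_Algebras"
begin

text \<open>
  Finite-dimensional modules over the preprojective algebra of type $A_{n-1}$, as graded
  representations of the doubled quiver. The graded pieces are subspaces of one ambient vector
  space with scalar multiplication \<open>scal\<close>; they are not required to be independent inside it, so
  the module is the external direct sum of the pieces. Only the restrictions of \<open>up M i\<close> and
  \<open>down M i\<close> to \<open>piece M i\<close> matter.
\<close>

record ('k, 'v) preproj_rep =
  scal :: "'k \<Rightarrow> 'v \<Rightarrow> 'v"
  piece :: "nat \<Rightarrow> 'v set"
  up :: "nat \<Rightarrow> 'v \<Rightarrow> 'v"    \<comment> \<open>\<open>up M i\<close> is \<open>i \<rightarrow> i + 1\<close>\<close>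
  down :: "nat \<Rightarrow> 'v \<Rightarrow> 'v"  \<comment> \<open>\<open>down M i\<close> is \<open>i \<rightarrow> i - 1\<close>\<close>

definition linear_between ::
  "('k \<Rightarrow> 'v \<Rightarrow> 'v) \<Rightarrow> ('k \<Rightarrow> 'w \<Rightarrow> 'w) \<Rightarrow> 'v::plus set \<Rightarrow> 'w::plus set \<Rightarrow> ('v \<Rightarrow> 'w) \<Rightarrow> bool"
where
  "linear_between s t U V f \<longleftrightarrow>
     (\<forall>x\<in>U. f x \<in> V) \<and>
     (\<forall>x\<in>U. \<forall>y\<in>U. f (x + y) = f x + f y) \<and>
     (\<forall>c. \<forall>x\<in>U. f (s c x) = t c (f x))"

text \<open>
  Since \<open>piece M 0\<close> and \<open>piece M n\<close> are zero, the maps \<open>down M 1\<close> and \<open>up M (n - 1)\<close>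
  vanish on the module.
\<close>

locale preproj_module =
  fixes n :: nat and M :: "('k::field, 'v::ab_group_add) preproj_rep"
  assumes vector_space: "vector_space (scal M)"
    and subspace: "\<And>i. i \<in> {1..n-1} \<Longrightarrow> module.subspace (scal M) (piece M i)"
    and finite_dim: "\<And>i. i \<in> {1..n-1} \<Longrightarrow> \<exists>S. finite S \<and> module.span (scal M) S = piece M i"
    and piece_0: "piece M 0 = {0}"
    and piece_n: "piece M n = {0}"
    and up_linear: "\<And>i. i \<in> {1..n-1} \<Longrightarrow>
      linear_between (scal M) (scal M) (piece M i) (piece M (i + 1)) (up M i)"
    and down_linear: "\<And>i. i \<in> {1..n-1} \<Longrightarrow>
      linear_between (scal M) (scal M) (piece M i) (piece M (i - 1)) (down M i)"
    and preproj_relation: "\<And>i v. i \<in> {1..n-1} \<Longrightarrow> v \<in> piece M i \<Longrightarrow>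
      down M (i + 1) (up M i v) = up M (i - 1) (down M i v)"

text \<open>
  A homomorphism is a family of linear maps between the pieces. To make equality of families
  equality of HOL functions, each family is extended by zero outside the pieces.
\<close>

definition preproj_Hom ::
  "nat \<Rightarrow> ('k::field, 'v::ab_group_add) preproj_rep \<Rightarrow> ('k, 'w::ab_group_add) preproj_rep
    \<Rightarrow> (nat \<Rightarrow> 'v \<Rightarrow> 'w) set"
where
  "preproj_Hom n M N = {f.
     (\<forall>i\<in>{1..n-1}. linear_between (scal M) (scal N) (piece M i) (piece N i) (f i)) \<and>
     (\<forall>i v. \<not> (i \<in> {1..n-1} \<and> v \<in> piece M i) \<longrightarrow> f i v = 0) \<and>
     (\<forall>i\<in>{1..n-2}. \<forall>v\<in>piece M i. f (i + 1) (up M i v) = up N i (f i v)) \<and>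
     (\<forall>i\<in>{2..n-1}. \<forall>v\<in>piece M i. f (i - 1) (down M i v) = down N i (f i v))}"

definition Hom_scal ::
  "('k::field, 'w::ab_group_add) preproj_rep \<Rightarrow> 'k \<Rightarrow> (nat \<Rightarrow> 'v \<Rightarrow> 'w) \<Rightarrow> (nat \<Rightarrow> 'v \<Rightarrow> 'w)"
where
  "Hom_scal N c f = (\<lambda>i v. scal N c (f i v))"


text \<open>The \<open>k\<close>-th smallest element of a finite set of naturals, counting from \<open>k = 1\<close>.\<close>

definition nth_elem :: "nat set \<Rightarrow> nat \<Rightarrow> nat" where
  "nth_elem A k = sorted_list_of_set A ! (k - 1)"

definition maya_index :: "nat set \<Rightarrow> (nat \<times> nat) set" where
  "maya_index A = {(j, k). 1 \<le> k \<and> k \<le> card A \<and> k \<le> j \<and> j \<le> nth_elem A k - 1}"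

text \<open>
  The ambient space of \<open>N(A)\<close> is the space of all functions \<open>nat \<times> nat \<Rightarrow> 'k\<close>; the basis
  vector \<open>w\<^sub>j\<^sub>,\<^sub>k\<close> is the indicator function of \<open>(j, k)\<close>.
\<close>

definition fun_scal :: "'k::field \<Rightarrow> ('a \<Rightarrow> 'k) \<Rightarrow> ('a \<Rightarrow> 'k)" where
  "fun_scal c v = (\<lambda>p. c * v p)"

definition maya_w :: "nat set \<Rightarrow> nat \<Rightarrow> nat \<Rightarrow> (nat \<times> nat \<Rightarrow> 'k::field)" where
  "maya_w A j k = (if (j, k) \<in> maya_index A then (\<lambda>p. if p = (j, k) then 1 else 0) else 0)"

text \<open>
  The maps of \<open>N(A)\<close> are the linear extensions of their values on the basis vectors
  (see \<open>maya_up_w\<close> and \<open>maya_down_w\<close> below); \<open>v (j, k)\<close> is the coordinate of \<open>v\<close> at \<open>w\<^sub>j\<^sub>,\<^sub>k\<close>.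
\<close>

definition maya :: "nat set \<Rightarrow> ('k::field, nat \<times> nat \<Rightarrow> 'k) preproj_rep" where
  "maya A = \<lparr>
     scal = fun_scal,
     piece = (\<lambda>j. module.span fun_scal {maya_w A j k | k. (j, k) \<in> maya_index A}),
     up = (\<lambda>j v. \<Sum>k\<in>{1..card A}. fun_scal (v (j, k)) (maya_w A (j + 1) (k + 1))),
     down = (\<lambda>j v. \<Sum>k\<in>{1..card A}. fun_scal (v (j, k)) (maya_w A (j - 1) k)) \<rparr>"


lemma vector_space_fun_scal: "vector_space fun_scal"
  by unfold_locales (simp_all add: fun_scal_def fun_eq_iff algebra_simps)

interpretation fun_vs: vector_space fun_scal
  by (rule vector_space_fun_scal)

lemma sum_fun_apply: "sum f S x = (\<Sum>a\<in>S. f a x)"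
  by (induction S rule: infinite_finite_induct) auto

lemma maya_w_apply:
  "maya_w A j k p = (if (j, k) \<in> maya_index A \<and> p = (j, k) then 1 else 0)"
  by (simp add: maya_w_def)

lemma maya_up_apply: "up (maya A) j v p =
    (\<Sum>k\<in>{1..card A}. v (j, k) * maya_w A (j + 1) (k + 1) p)"
  by (simp add: maya_def sum_fun_apply fun_scal_def)

lemma maya_down_apply: "down (maya A) j v p =
    (\<Sum>k\<in>{1..card A}. v (j, k) * maya_w A (j - 1) k p)"
  by (simp add: maya_def sum_fun_apply fun_scal_def)

lemma maya_indexD: "(j, k) \<in> maya_index A \<Longrightarrow> k \<in> {1..card A}"
  by (auto simp: maya_index_def)

lemma maya_up_w:
  assumes "(j, k) \<in> maya_index A"
  shows "up (maya A) j (maya_w A j k) = maya_w A (j + 1) (k + 1)"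
proof
  fix p
  have "up (maya A) j (maya_w A j k) p =
      (\<Sum>k'\<in>{1..card A}. if k' = k then maya_w A (j + 1) (k + 1) p else 0)"
    unfolding maya_up_apply using assms by (intro sum.cong) (auto simp: maya_w_apply)
  then show "up (maya A) j (maya_w A j k) p = maya_w A (j + 1) (k + 1) p"
    using maya_indexD[OF assms] by simp
qed

lemma maya_down_w:
  assumes "(j, k) \<in> maya_index A"
  shows "down (maya A) j (maya_w A j k) = maya_w A (j - 1) k"
proof
  fix p
  have "down (maya A) j (maya_w A j k) p =
      (\<Sum>k'\<in>{1..card A}. if k' = k then maya_w A (j - 1) k p else 0)"
    unfolding maya_down_apply using assms by (intro sum.cong) (auto simp: maya_w_apply)
  then show "down (maya A) j (maya_w A j k) p = maya_w A (j - 1) k p"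
    using maya_indexD[OF assms] by simp
qed

lemma finite_maya_w: "finite {maya_w A j k | k. (j, k) \<in> maya_index A}"
proof -
  have "{maya_w A j k | k. (j, k) \<in> maya_index A} \<subseteq> maya_w A j ` {1..card A}"
    using maya_indexD by auto
  then show ?thesis
    by (rule finite_subset) simp
qed

lemma piece_maya_iff:
  "v \<in> piece (maya A) j \<longleftrightarrow> (\<forall>p. v p \<noteq> 0 \<longrightarrow> p \<in> maya_index A \<and> fst p = j)"
proof
  assume "v \<in> piece (maya A) j"
  then have "v \<in> fun_vs.span {maya_w A j k | k. (j, k) \<in> maya_index A}"
    by (simp add: maya_def)
  then show "\<forall>p. v p \<noteq> 0 \<longrightarrow> p \<in> maya_index A \<and> fst p = j"
  proof (induction rule: fun_vs.span_induct_alt)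
    case base
    then show ?case by simp
  next
    case (step c x y)
    then show ?case
      by (auto simp: fun_scal_def maya_w_apply split: if_splits)
  qed
next
  assume v: "\<forall>p. v p \<noteq> 0 \<longrightarrow> p \<in> maya_index A \<and> fst p = j"
  let ?K = "{k \<in> {1..card A}. (j, k) \<in> maya_index A}"
  have "v = (\<Sum>k\<in>?K. fun_scal (v (j, k)) (maya_w A j k))"
  proof
    fix p
    have "(\<Sum>k\<in>?K. fun_scal (v (j, k)) (maya_w A j k)) p =
        (\<Sum>k\<in>?K. if k = snd p then (if fst p = j then v p else 0) else 0)"
      unfolding sum_fun_apply
      by (intro sum.cong) (auto simp: fun_scal_def maya_w_apply prod_eq_iff)
    also have "\<dots> = v p"
    proof (cases "v p = 0")
      case False
      with v have "p \<in> maya_index A" "fst p = j"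
        by blast+
      moreover from this have "(j, snd p) \<in> maya_index A" "snd p \<in> {1..card A}"
        using maya_indexD[of "fst p" "snd p" A] by auto
      ultimately show ?thesis
        by simp
    qed (simp add: if_distrib cong: if_cong)
    finally show "v p = (\<Sum>k\<in>?K. fun_scal (v (j, k)) (maya_w A j k)) p" ..
  qed
  also have "\<dots> \<in> fun_vs.span {maya_w A j k | k. (j, k) \<in> maya_index A}"
    by (intro fun_vs.span_sum fun_vs.span_scale fun_vs.span_base) auto
  finally show "v \<in> piece (maya A) j"
    by (simp add: maya_def)
qed

lemma maya_w_in_piece: "maya_w A j k \<in> piece (maya A) j"
  by (auto simp: piece_maya_iff maya_w_apply)

lemma independent_maya_w:
  "\<not> module.dependent fun_scal
     {maya_w A j k :: nat \<times> nat \<Rightarrow> 'k::field | j k. (j, k) \<in> maya_index A}"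
proof -
  let ?W = "{maya_w A j k :: nat \<times> nat \<Rightarrow> 'k | j k. (j, k) \<in> maya_index A}"
  have "maya_w A j k \<notin> fun_vs.span (?W - {maya_w A j k})"
    if jk: "(j, k) \<in> maya_index A" for j k
  proof
    assume "maya_w A j k \<in> fun_vs.span (?W - {maya_w A j k})"
    then have "maya_w A j k (j, k) = (0 :: 'k)"
    proof (induction rule: fun_vs.span_induct_alt)
      case base
      then show ?case by simp
    next
      case (step c x y)
      then obtain j' k' where "x = maya_w A j' k'" "x \<noteq> maya_w A j k"
        by auto
      then have "x (j, k) = 0"
        by (auto simp: maya_w_apply)
      with step show ?case
        by (simp add: fun_scal_def)
    qed
    then show False
      using jk by (simp add: maya_w_apply)
  qed
  then show ?thesis
    unfolding fun_vs.dependent_def by blast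
qed

lemma inj_on_maya_w:
  "inj_on (\<lambda>(j, k). maya_w A j k :: nat \<times> nat \<Rightarrow> 'k::field) (maya_index A)"
proof (rule inj_onI, clarify)
  fix j k j' k'
  assume jk: "(j, k) \<in> maya_index A"
    and eq: "(maya_w A j k :: nat \<times> nat \<Rightarrow> 'k) = maya_w A j' k'"
  from eq have "(maya_w A j k (j, k) :: 'k) = maya_w A j' k' (j, k)"
    by simp
  with jk show "j = j' \<and> k = k'"
    by (simp add: maya_w_apply split: if_splits)
qed

lemma nth_elem_in: "finite A \<Longrightarrow> k \<in> {1..card A} \<Longrightarrow> nth_elem A k \<in> A"
  by (metis One_nat_def Suc_le_eq Suc_pred atLeastAtMost_iff length_sorted_list_of_set
      nth_elem_def nth_mem set_sorted_list_of_set zero_less_Suc less_le_trans zero_less_one)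

lemma nth_elem_less:
  assumes "1 \<le> k" "k < l" "l \<le> card A"
  shows "nth_elem A k < nth_elem A l"
  unfolding nth_elem_def
  using assms by (intro sorted_wrt_nth_less[OF strict_sorted_list_of_set]) auto

lemma maya_index_bounds:
  assumes "A \<subseteq> {1..n}" "(j, k) \<in> maya_index A"
  shows "j \<in> {1..n-1}"
proof -
  have "finite A"
    using assms(1) finite_subset by blast
  then have "nth_elem A k \<in> A"
    using assms(2) maya_indexD nth_elem_in by blast
  then have "1 \<le> nth_elem A k" "nth_elem A k \<le> n"
    using assms(1) by auto
  then show ?thesis
    using assms(2) by (auto simp: maya_index_def)
qed

lemma maya_index_up:
  assumes "(j, k) \<in> maya_index A" "k < card A"
  shows "(j + 1, k + 1) \<in> maya_index A"
  using assms nth_elem_less[of k "k + 1" A] by (auto simp: maya_index_def)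

lemma maya_relation_w:
  assumes "(j, k) \<in> maya_index A"
  shows "down (maya A) (j + 1) (up (maya A) j (maya_w A j k)) =
         (up (maya A) (j - 1) (down (maya A) j (maya_w A j k)) :: nat \<times> nat \<Rightarrow> 'k::field)"
proof -
  have zero: "up (maya A) i 0 = (0 :: nat \<times> nat \<Rightarrow> 'k)"
    "down (maya A) i 0 = (0 :: nat \<times> nat \<Rightarrow> 'k)" for i
    by (simp_all add: fun_eq_iff maya_up_apply maya_down_apply)
  have [simp]: "j - 1 + 1 = j"
    using assms by (auto simp: maya_index_def)
  have "down (maya A) (j + 1) (maya_w A (j + 1) (k + 1)) =
      (maya_w A j (k + 1) :: nat \<times> nat \<Rightarrow> 'k)"
  proof (cases "(j + 1, k + 1) \<in> maya_index A")
    case True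
    then show ?thesis by (simp add: maya_down_w)
  next
    case False
    then have "\<not> k < card A"
      using maya_index_up assms by blast
    then have "(j, k + 1) \<notin> maya_index A"
      by (auto simp: maya_index_def)
    with False show ?thesis
      by (simp add: maya_w_def zero)
  qed
  moreover have "up (maya A) (j - 1) (maya_w A (j - 1) k) =
      (maya_w A j (k + 1) :: nat \<times> nat \<Rightarrow> 'k)"
  proof (cases "(j - 1, k) \<in> maya_index A")
    case True
    then show ?thesis by (simp only: maya_up_w \<open>j - 1 + 1 = j\<close>)
  next
    case False
    then have "j - 1 < k"
      using assms by (auto simp: maya_index_def)
    then have "(j, k + 1) \<notin> maya_index A"
      by (auto simp: maya_index_def)
    with False show ?thesis
      by (simp add: maya_w_def zero)
  qed
  ultimately show ?thesis
    by (simp only: maya_up_w[OF assms] maya_down_w[OF assms])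
qed

lemma maya_up_linear:
  "up (maya A) j (x + y) = up (maya A) j x + up (maya A) j y"
  "up (maya A) j (fun_scal c x) = fun_scal c (up (maya A) j x)"
  by (simp_all add: fun_eq_iff maya_up_apply fun_scal_def algebra_simps
      sum.distrib sum_distrib_left)

lemma maya_down_linear:
  "down (maya A) j (x + y) = down (maya A) j x + down (maya A) j y"
  "down (maya A) j (fun_scal c x) = fun_scal c (down (maya A) j x)"
  by (simp_all add: fun_eq_iff maya_down_apply fun_scal_def algebra_simps
      sum.distrib sum_distrib_left)

lemma subspace_piece_maya: "fun_vs.subspace (piece (maya A) j)"
  by (simp add: maya_def)

lemma scal_maya [simp]: "scal (maya A) = fun_scal"
  by (simp add: maya_def)

theorem preproj_module_maya:
  assumes A: "A \<subseteq> {1..n}"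
  shows "preproj_module n (maya A :: ('k::field, nat \<times> nat \<Rightarrow> 'k) preproj_rep)"
proof -
  let ?M = "maya A :: ('k, nat \<times> nat \<Rightarrow> 'k) preproj_rep"
  have zero_piece: "piece ?M j = {0}" if "j \<notin> {1..n-1}" for j
  proof -
    have no: "\<not> (p \<in> maya_index A \<and> fst p = j)" for p
      using that maya_index_bounds[OF A, of "fst p" "snd p"] by auto
    have "v = 0" if "v \<in> piece ?M j" for v
    proof
      fix p
      show "v p = 0 p"
        using no[of p] that unfolding piece_maya_iff zero_fun_apply by blast
    qed
    moreover have "0 \<in> piece ?M j"
      by (simp add: piece_maya_iff)
    ultimately show ?thesis
      by blast
  qed
  show ?thesis
  proof (unfold scal_maya preproj_module_def, intro conjI allI impI)
    fix i
    show "\<exists>S. finite S \<and> fun_vs.span S = piece ?M i"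
      by (rule exI[of _ "{maya_w A i k | k. (i, k) \<in> maya_index A}"])
        (simp add: finite_maya_w, simp add: maya_def)
    have up_in: "up ?M i x \<in> piece ?M (i + 1)" for x
    proof -
      have "fun_scal c (maya_w A (i + 1) k) \<in> piece ?M (i + 1)" for c k
        by (intro fun_vs.subspace_scale[OF subspace_piece_maya] maya_w_in_piece)
      then have "(\<Sum>k\<in>{1..card A}. fun_scal (x (i, k)) (maya_w A (i + 1) (k + 1)))
          \<in> piece ?M (i + 1)"
        by (intro fun_vs.subspace_sum[OF subspace_piece_maya])
      moreover have "up ?M i x =
          (\<Sum>k\<in>{1..card A}. fun_scal (x (i, k)) (maya_w A (i + 1) (k + 1)))"
        by (simp add: maya_def)
      ultimately show ?thesis by simp
    qed
    show "linear_between fun_scal fun_scal (piece ?M i) (piece ?M (i + 1)) (up ?M i)"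
      unfolding linear_between_def using up_in by (simp add: maya_up_linear)
    have down_in: "down ?M i x \<in> piece ?M (i - 1)" for x
    proof -
      have "fun_scal c (maya_w A (i - 1) k) \<in> piece ?M (i - 1)" for c k
        by (intro fun_vs.subspace_scale[OF subspace_piece_maya] maya_w_in_piece)
      then have "(\<Sum>k\<in>{1..card A}. fun_scal (x (i, k)) (maya_w A (i - 1) k))
          \<in> piece ?M (i - 1)"
        by (intro fun_vs.subspace_sum[OF subspace_piece_maya])
      moreover have "down ?M i x =
          (\<Sum>k\<in>{1..card A}. fun_scal (x (i, k)) (maya_w A (i - 1) k))"
        by (simp add: maya_def)
      ultimately show ?thesis by simp
    qed
    show "linear_between fun_scal fun_scal (piece ?M i) (piece ?M (i - 1)) (down ?M i)"
      unfolding linear_between_def using down_in by (simp add: maya_down_linear)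
    fix v
    assume "v \<in> piece ?M i"
    then have "v \<in> fun_vs.span {maya_w A i k | k. (i, k) \<in> maya_index A}"
      by (simp add: maya_def)
    then show "down ?M (i + 1) (up ?M i v) = up ?M (i - 1) (down ?M i v)"
    proof (induction rule: fun_vs.span_induct_alt)
      case base
      then show ?case
        by (simp add: fun_eq_iff maya_up_apply maya_down_apply)
    next
      case (step c x y)
      then obtain k where x: "x = maya_w A i k" and k: "(i, k) \<in> maya_index A"
        by blast
      have "down ?M (i + 1) (up ?M i x) = up ?M (i - 1) (down ?M i x)"
        unfolding x by (rule maya_relation_w[OF k])
      with step(2) show ?case
        by (simp only: maya_up_linear maya_down_linear)
    qed
  next
    have "n \<notin> {1..n-1}"
      by auto
    then show "piece ?M n = {0}"
      by (rule zero_piece)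
    show "piece ?M 0 = {0}"
      by (rule zero_piece) simp
  qed (use subspace_piece_maya vector_space_fun_scal in auto)
qed

lemma vector_space_Hom_scal:
  assumes "vector_space (scal N)"
  shows "vector_space (Hom_scal N)"
proof -
  interpret N: vector_space "scal N" by fact
  show ?thesis
    by unfold_locales
      (simp_all add: Hom_scal_def fun_eq_iff N.scale_right_distrib N.scale_left_distrib)
qed

text \<open>
  \<open>vector_space.dim\<close> is \<open>0\<close> on infinite-dimensional spaces; this does not arise for the space of
  homomorphisms, by the following two facts.
\<close>

theorem subspace_preproj_Hom:
  assumes "preproj_module n M" "preproj_module n N"
  shows "module.subspace (Hom_scal N) (preproj_Hom n M N)"
proof -
  interpret M: preproj_module n M by fact
  interpret N: preproj_module n N by fact
  interpret MV: vector_space "scal M" by (rule M.vector_space)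
  interpret NV: vector_space "scal N" by (rule N.vector_space)
  interpret H: vector_space "Hom_scal N"
    by (rule vector_space_Hom_scal[OF N.vector_space])
  have piece_N: "0 \<in> piece N i" "\<And>x y. x \<in> piece N i \<Longrightarrow> y \<in> piece N i \<Longrightarrow> x + y \<in> piece N i"
    "\<And>c x. x \<in> piece N i \<Longrightarrow> scal N c x \<in> piece N i" if "i \<in> {1..n-1}" for i
    using N.subspace[OF that] unfolding NV.subspace_def by auto
  have up_N: "up N i (x + y) = up N i x + up N i y" "up N i (scal N c x) = scal N c (up N i x)"
    if "i \<in> {1..n-1}" "x \<in> piece N i" "y \<in> piece N i" for i x y c
    using N.up_linear[OF that(1)] that unfolding linear_between_def by auto
  have down_N: "down N i (x + y) = down N i x + down N i y"
    "down N i (scal N c x) = scal N c (down N i x)"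
    if "i \<in> {1..n-1}" "x \<in> piece N i" "y \<in> piece N i" for i x y c
    using N.down_linear[OF that(1)] that unfolding linear_between_def by auto
  have z: "up N i 0 = 0" "down N i 0 = 0" if "i \<in> {1..n-1}" for i
    using up_N(2)[OF that piece_N(1)[OF that] piece_N(1)[OF that], of 0]
      down_N(2)[OF that piece_N(1)[OF that] piece_N(1)[OF that], of 0]
    by simp_all
  show ?thesis
  proof (rule H.subspaceI)
    show "0 \<in> preproj_Hom n M N"
      unfolding preproj_Hom_def linear_between_def using piece_N(1) z by auto
  next
    fix f g assume f: "f \<in> preproj_Hom n M N" and g: "g \<in> preproj_Hom n M N"
    have fp: "f i v \<in> piece N i" "g i v \<in> piece N i" if "i \<in> {1..n-1}" "v \<in> piece M i" for i v
      using f g that unfolding preproj_Hom_def linear_between_def by auto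
    have sub: "{1..n-2} \<subseteq> {1..n-1}" "{2..n-1} \<subseteq> {1..n-1}"
      by auto
    have lin: "linear_between (scal M) (scal N) (piece M i) (piece N i) ((f + g) i)"
      if i: "i \<in> {1..n-1}" for i
      using f g i piece_N(2)[OF i] unfolding preproj_Hom_def linear_between_def
      by (auto simp: NV.scale_right_distrib)
    have u: "(f + g) (i + 1) (up M i v) = up N i ((f + g) i v)"
      if "i \<in> {1..n-2}" "v \<in> piece M i" for i v
      using f g that up_N(1)[OF _ fp] sub unfolding preproj_Hom_def by auto
    have d: "(f + g) (i - 1) (down M i v) = down N i ((f + g) i v)"
      if "i \<in> {2..n-1}" "v \<in> piece M i" for i v
      using f g that down_N(1)[OF _ fp] sub unfolding preproj_Hom_def by auto
    show "f + g \<in> preproj_Hom n M N"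
      using lin u d f g unfolding preproj_Hom_def by auto
  next
    fix c f assume f: "f \<in> preproj_Hom n M N"
    have fp: "f i v \<in> piece N i" if "i \<in> {1..n-1}" "v \<in> piece M i" for i v
      using f that unfolding preproj_Hom_def linear_between_def by auto
    have sub: "{1..n-2} \<subseteq> {1..n-1}" "{2..n-1} \<subseteq> {1..n-1}"
      by auto
    have lin: "linear_between (scal M) (scal N) (piece M i) (piece N i) (Hom_scal N c f i)"
      if i: "i \<in> {1..n-1}" for i
      using f i piece_N(3)[OF i] unfolding preproj_Hom_def linear_between_def Hom_scal_def
      by (auto simp: NV.scale_right_distrib mult.commute)
    have u: "Hom_scal N c f (i + 1) (up M i v) = up N i (Hom_scal N c f i v)"
      if "i \<in> {1..n-2}" "v \<in> piece M i" for i v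
      using f that up_N(2)[OF _ fp fp] sub unfolding preproj_Hom_def Hom_scal_def by auto
    have d: "Hom_scal N c f (i - 1) (down M i v) = down N i (Hom_scal N c f i v)"
      if "i \<in> {2..n-1}" "v \<in> piece M i" for i v
      using f that down_N(2)[OF _ fp fp] sub unfolding preproj_Hom_def Hom_scal_def by auto
    show "Hom_scal N c f \<in> preproj_Hom n M N"
      using lin u d f unfolding preproj_Hom_def by (auto simp: Hom_scal_def)
  qed
qed

theorem finite_dim_preproj_Hom:
  assumes "preproj_module n M" "preproj_module n N"
  shows "\<exists>S. finite S \<and> preproj_Hom n M N \<subseteq> module.span (Hom_scal N) S"
proof -
  interpret M: preproj_module n M by fact
  interpret N: preproj_module n N by fact
  interpret MV: vector_space "scal M" by (rule M.vector_space)
  interpret NV: vector_space "scal N" by (rule N.vector_space)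
  interpret H: vector_space "Hom_scal N"
    by (rule vector_space_Hom_scal[OF N.vector_space])
  have "\<exists>B. finite B \<and> MV.independent B \<and> MV.span B = piece M i" if i: "i \<in> {1..n-1}" for i
  proof -
    obtain S where S: "finite S" "MV.span S = piece M i"
      using M.finite_dim[OF i] by auto
    obtain B where "B \<subseteq> S" "MV.independent B" "S \<subseteq> MV.span B"
      using MV.maximal_independent_subset[of S] by blast
    then show ?thesis
      using S by (metis MV.span_mono MV.span_span finite_subset subset_antisym)
  qed
  then obtain B where B: "\<And>i. i \<in> {1..n-1} \<Longrightarrow>
      finite (B i) \<and> MV.independent (B i) \<and> MV.span (B i) = piece M i"
    by metis
  obtain C where C: "\<And>i. i \<in> {1..n-1} \<Longrightarrow> finite (C i) \<and> NV.span (C i) = piece N i"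
    using N.finite_dim by metis
  define E where "E = (\<lambda>i b c i' v.
    if i' = i \<and> v \<in> piece M i then scal N (MV.representation (B i) v b) c else 0)"
  define S where "S = (\<Union>i\<in>{1..n-1}. \<Union>b\<in>B i. \<Union>c\<in>C i. {E i b c})"
  have "finite S"
    unfolding S_def using B C by blast
  moreover have "f \<in> H.span S" if f: "f \<in> preproj_Hom n M N" for f
  proof -
    have "\<exists>u. f i b = (\<Sum>c\<in>C i. scal N (u c) c)" if "i \<in> {1..n-1}" "b \<in> B i" for i b
    proof -
      have "b \<in> piece M i"
        using B[OF that(1)] that(2) MV.span_base by blast
      then have "f i b \<in> NV.span (C i)"
        using f that(1) C[OF that(1)] unfolding preproj_Hom_def linear_between_def by auto
      moreover have "NV.span (C i) = range (\<lambda>u. \<Sum>c\<in>C i. scal N (u c) c)"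
        using C[OF that(1)] NV.span_finite by blast
      ultimately show ?thesis
        by blast
    qed
    then obtain u where u: "\<And>i b. i \<in> {1..n-1} \<Longrightarrow> b \<in> B i \<Longrightarrow>
        f i b = (\<Sum>c\<in>C i. scal N (u i b c) c)"
      by metis
    have "f = (\<Sum>i\<in>{1..n-1}. \<Sum>b\<in>B i. \<Sum>c\<in>C i. Hom_scal N (u i b c) (E i b c))"
    proof (intro ext)
      fix i v
      let ?r = "MV.representation (B i) v"
      have rhs: "(\<Sum>i\<in>{1..n-1}. \<Sum>b\<in>B i. \<Sum>c\<in>C i. Hom_scal N (u i b c) (E i b c)) i v =
          (\<Sum>i'\<in>{1..n-1}. \<Sum>b\<in>B i'. \<Sum>c\<in>C i'. scal N (u i' b c) (E i' b c i v))"
        by (simp add: sum_fun_apply Hom_scal_def)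
      show "f i v =
          (\<Sum>i\<in>{1..n-1}. \<Sum>b\<in>B i. \<Sum>c\<in>C i. Hom_scal N (u i b c) (E i b c)) i v"
      proof (cases "i \<in> {1..n-1} \<and> v \<in> piece M i")
        case False
        then have "f i v = 0"
          using f unfolding preproj_Hom_def by blast
        moreover have "E i' b c i v = 0" if "i' \<in> {1..n-1}" for i' b c
          using False that by (auto simp: E_def)
        ultimately show ?thesis
          unfolding rhs by simp
      next
        case True
        then have i: "i \<in> {1..n-1}" and v: "v \<in> piece M i"
          by auto
        have lin: "f i (x + y) = f i x + f i y" "f i (scal M a x) = scal N a (f i x)"
          if "x \<in> piece M i" "y \<in> piece M i" for x y a
          using f i that unfolding preproj_Hom_def linear_between_def by auto
        have pM: "MV.subspace (piece M i)"
          using M.subspace[OF i] .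
        have bM: "b \<in> piece M i" if "b \<in> B i" for b
          using B[OF i] that MV.span_base by blast
        have f0: "f i 0 = 0"
          using lin(2)[of 0 0 0] MV.subspace_0[OF pM] by simp
        have "f i (\<Sum>b\<in>T. scal M (?r b) b) = (\<Sum>b\<in>T. scal N (?r b) (f i b))"
          if "finite T" "T \<subseteq> B i" for T
          using that
        proof (induction T rule: finite_induct)
          case empty
          then show ?case by (simp add: f0)
        next
          case (insert b T)
          have "scal M (?r b) b \<in> piece M i"
            using insert bM MV.subspace_scale[OF pM] by auto
          moreover have "(\<Sum>b\<in>T. scal M (?r b) b) \<in> piece M i"
            using insert bM MV.subspace_scale[OF pM] by (intro MV.subspace_sum[OF pM]) auto
          ultimately show ?case
            using insert bM lin by auto
        qed
        from this[of "B i"] have "f i v = (\<Sum>b\<in>B i. scal N (?r b) (f i b))"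
          using B[OF i] v MV.sum_representation_eq[of "B i" v "B i"] by simp
        also have "\<dots> = (\<Sum>b\<in>B i. \<Sum>c\<in>C i. scal N (u i b c) (E i b c i v))"
          using v u[OF i]
          by (intro sum.cong) (simp_all add: E_def NV.scale_sum_right mult.commute)
        also have "\<dots> = (\<Sum>i'\<in>{1..n-1}. if i' = i then
            (\<Sum>b\<in>B i. \<Sum>c\<in>C i. scal N (u i b c) (E i b c i v)) else 0)"
          using i by simp
        also have "\<dots> =
            (\<Sum>i'\<in>{1..n-1}. \<Sum>b\<in>B i'. \<Sum>c\<in>C i'. scal N (u i' b c) (E i' b c i v))"
          by (intro sum.cong) (auto simp: E_def)
        finally show ?thesis
          unfolding rhs .
      qed
    qed
    also have "\<dots> \<in> H.span S"
      unfolding S_def by (intro H.span_sum H.span_scale H.span_base) blast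
    finally show ?thesis .
  qed
  ultimately show ?thesis
    by blast
qed

end

theory Submission
  imports Defs
begin

text \<open>
  Writing \<open>d = p - k\<close>, the basis of \<open>N(B)\<close> is a Young diagram in the \<open>(d, k)\<close>-plane, along which
  \<open>up\<close> raises \<open>k\<close> and \<open>down\<close> lowers \<open>d\<close>. The socle of \<open>N(B)\<close> is therefore spanned by the corner
  \<open>w\<^sub>j\<^sub>,\<^sub>j\<close>, and a homomorphism \<open>f\<close> is determined by the functional \<open>v \<mapsto> f\<^sub>j(v)(j, j)\<close> on \<open>N(A)\<^sub>j\<close>, that
  is, by its values \<open>c\<^sub>r\<close> on the \<open>w\<^sub>j\<^sub>,\<^sub>r\<close>. Conversely, \<open>c\<^sub>r\<close> contributes the translation
  \<open>w\<^sub>p\<^sub>,\<^sub>k \<mapsto> w\<^sub>p\<^sub>,\<^sub>k\<^sub>+\<^sub>j\<^sub>-\<^sub>r\<close>, which is a homomorphism into \<open>N(B)\<close> exactly when the part of the diagram of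
  \<open>A\<close> with \<open>k \<le> r\<close> is, after this translation, contained in the diagram of \<open>B\<close> wherever \<open>d \<ge> 0\<close>.
\<close>

section \<open>The diagram of a Maya module and the coordinates of its maps\<close>

lemma maya_index_iff:
  "(p, k) \<in> maya_index A \<longleftrightarrow> 1 \<le> k \<and> k \<le> card A \<and> k \<le> p \<and> p < nth_elem A k"
  by (auto simp: maya_index_def)

lemma nth_elem_ge:
  assumes "A \<subseteq> {1..n}" "1 \<le> k" "k \<le> card A"
  shows "k \<le> nth_elem A k"
  using assms(2,3)
proof (induction k rule: nat_induct_at_least)
  case base
  have "nth_elem A 1 \<in> A"
    using assms(1) base finite_subset by (intro nth_elem_in) auto
  then show ?case
    using assms(1) by auto
next
  case (Suc k)
  then show ?case
    using nth_elem_less[of k "Suc k" A] by auto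
qed

lemma maya_index_up_add:
  "(p, k) \<in> maya_index A \<Longrightarrow> k + m \<le> card A \<Longrightarrow> (p + m, k + m) \<in> maya_index A"
proof (induction m)
  case (Suc m)
  then show ?case
    using maya_index_up[of "p + m" "k + m" A] by simp
qed simp

lemma maya_index_down:
  "(p, k) \<in> maya_index A \<Longrightarrow> k \<le> q \<Longrightarrow> q \<le> p \<Longrightarrow> (q, k) \<in> maya_index A"
  by (auto simp: maya_index_iff)

text \<open>Row \<open>k\<close> receives only from row \<open>k - 1\<close>, and the rows of the
  source start at 1. Hence the guard \<open>2 \<le> k\<close>, which keeps the truncated
  \<open>k - 1\<close> from naming row 0.\<close>

lemma maya_up_coord:
  "up (maya A) p v (q, k) =
     (if q = p + 1 \<and> 2 \<le> k \<and> (q, k) \<in> maya_index A then v (p, k - 1) else 0)"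
proof -
  have "up (maya A) p v (q, k) = (\<Sum>l\<in>{1..card A}. if l = k - 1 then
      (if q = p + 1 \<and> 2 \<le> k \<and> (q, k) \<in> maya_index A then v (p, k - 1) else 0) else 0)"
    unfolding maya_up_apply by (intro sum.cong) (auto simp: maya_w_apply)
  then show ?thesis
    using maya_indexD[of q k A] by auto
qed

lemma maya_down_coord:
  "down (maya A) p v (q, k) =
     (if q = p - 1 \<and> (q, k) \<in> maya_index A then v (p, k) else 0)"
proof -
  have "down (maya A) p v (q, k) = (\<Sum>l\<in>{1..card A}. if l = k then
      (if q = p - 1 \<and> (q, k) \<in> maya_index A then v (p, k) else 0) else 0)"
    unfolding maya_down_apply by (intro sum.cong) (auto simp: maya_w_apply)
  then show ?thesis
    using maya_indexD[of q k A] by auto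
qed

lemma piece_maya_expand:
  assumes "v \<in> piece (maya A) p"
  shows "v = (\<Sum>k\<in>{1..card A}. fun_scal (v (p, k)) (maya_w A p k))"
proof
  fix x :: "nat \<times> nat"
  obtain q l where x: "x = (q, l)"
    by (cases x)
  have "(\<Sum>k\<in>{1..card A}. fun_scal (v (p, k)) (maya_w A p k)) x =
      (\<Sum>k\<in>{1..card A}. if k = l then v x else 0)"
    unfolding sum_fun_apply x
    using assms by (intro sum.cong) (auto simp: piece_maya_iff fun_scal_def maya_w_apply)
  also have "\<dots> = v x"
    using assms maya_indexD[of q l A] by (auto simp: piece_maya_iff x)
  finally show "v x = (\<Sum>k\<in>{1..card A}. fun_scal (v (p, k)) (maya_w A p k)) x" ..
qed

section \<open>Matrix entries of a homomorphism\<close>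

definition hom_coeff ::
  "nat set \<Rightarrow> (nat \<Rightarrow> (nat \<times> nat \<Rightarrow> 'k::field) \<Rightarrow> (nat \<times> nat \<Rightarrow> 'k)) \<Rightarrow> nat \<Rightarrow> nat \<Rightarrow> nat \<Rightarrow> 'k"
where
  "hom_coeff A f p k k' = f p (maya_w A p k) (p, k')"

context
  fixes n :: nat and A B :: "nat set"
    and f :: "nat \<Rightarrow> (nat \<times> nat \<Rightarrow> 'k::field) \<Rightarrow> (nat \<times> nat \<Rightarrow> 'k)"
  assumes A: "A \<subseteq> {1..n}" and B: "B \<subseteq> {1..n}"
    and f: "f \<in> preproj_Hom n (maya A) (maya B)"
begin

lemma hom_linear:
  assumes "p \<in> {1..n-1}"
  shows "linear_between fun_scal fun_scal (piece (maya A) p) (piece (maya B) p) (f p)"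
  using f assms by (simp add: preproj_Hom_def)

lemma hom_outside: "p \<notin> {1..n-1} \<Longrightarrow> f p v = 0"
  using f unfolding preproj_Hom_def by blast

lemma hom_in_piece:
  assumes "v \<in> piece (maya A) p"
  shows "f p v \<in> piece (maya B) p"
proof (cases "p \<in> {1..n-1}")
  case True
  then show ?thesis
    using hom_linear assms by (auto simp: linear_between_def)
next
  case False
  then show ?thesis
    by (simp add: hom_outside piece_maya_iff)
qed

lemma hom_zero: "f p 0 = 0"
proof (cases "p \<in> {1..n-1}")
  case True
  have "0 \<in> piece (maya A :: ('k, nat \<times> nat \<Rightarrow> 'k) preproj_rep) p"
    by (simp add: piece_maya_iff)
  then have "f p (fun_scal 0 0) = fun_scal 0 (f p 0)"
    using hom_linear[OF True] unfolding linear_between_def by blast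
  then show ?thesis
    by simp
qed (rule hom_outside)

lemma hom_coeff_eq_0_left: "(p, k) \<notin> maya_index A \<Longrightarrow> hom_coeff A f p k k' = 0"
  by (simp add: hom_coeff_def maya_w_def hom_zero)

lemma hom_coeff_eq_0_right: "(p, k') \<notin> maya_index B \<Longrightarrow> hom_coeff A f p k k' = 0"
  using hom_in_piece[OF maya_w_in_piece, of p k]
  by (auto simp: hom_coeff_def piece_maya_iff)

lemma hom_eq_sum:
  assumes v: "v \<in> piece (maya A) p"
  shows "f p v (p, k') = (\<Sum>k\<in>{1..card A}. v (p, k) * hom_coeff A f p k k')"
proof (cases "p \<in> {1..n-1}")
  case True
  have lin: "f p (x + y) = f p x + f p y" "f p (fun_scal c x) = fun_scal c (f p x)"
    if "x \<in> piece (maya A) p" "y \<in> piece (maya A) p" for x y c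
    using hom_linear[OF True] that by (auto simp: linear_between_def)
  have "f p (\<Sum>k\<in>T. fun_scal (v (p, k)) (maya_w A p k)) =
      (\<Sum>k\<in>T. fun_scal (v (p, k)) (f p (maya_w A p k)))" if "finite T" for T
    using that
  proof (induction T)
    case (insert k T)
    have w: "fun_scal c (maya_w A p k) \<in> piece (maya A) p" for c :: 'k and k
      by (intro fun_vs.subspace_scale[OF subspace_piece_maya] maya_w_in_piece)
    have "(\<Sum>k\<in>T. fun_scal (v (p, k)) (maya_w A p k)) \<in> piece (maya A) p"
      by (rule fun_vs.subspace_sum[OF subspace_piece_maya w])
    then show ?case
      by (simp only: sum.insert[OF insert.hyps] lin(1)[OF w] insert.IH
          lin(2)[OF maya_w_in_piece maya_w_in_piece])
  qed (simp only: sum.empty hom_zero)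
  from this[of "{1..card A}"] show ?thesis
    using piece_maya_expand[OF v] by (simp add: sum_fun_apply fun_scal_def hom_coeff_def)
next
  case False
  then show ?thesis
    by (simp add: hom_outside hom_coeff_def)
qed

text \<open>Compare the coordinates at \<open>(p + 1, k' + 1)\<close> in the commutation with
  \<open>up\<close>. The box \<open>(p + 1, k + 1)\<close> may be missing from \<open>A\<close>; the
  left side is then 0, which forces the entry on the right to vanish wherever the guard
  holds.\<close>

lemma hom_coeff_up:
  assumes k: "(p, k) \<in> maya_index A"
  shows "hom_coeff A f (p + 1) (k + 1) (k' + 1) =
    (if 1 \<le> k' \<and> (p + 1, k' + 1) \<in> maya_index B then hom_coeff A f p k k' else 0)"
proof (cases "p + 1 \<in> {1..n-1}")
  case True
  then have "p \<in> {1..n-2}"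
    using maya_index_bounds[OF A k] by auto
  then have "f (p + 1) (up (maya A) p (maya_w A p k)) = up (maya B) p (f p (maya_w A p k))"
    using f maya_w_in_piece unfolding preproj_Hom_def by blast
  then show ?thesis
    unfolding hom_coeff_def by (simp only: maya_up_w[OF k]) (auto simp: maya_up_coord)
next
  case False
  then show ?thesis
    using maya_index_bounds[OF B, of "p + 1" "k' + 1"] hom_coeff_eq_0_right by auto
qed

lemma hom_coeff_down:
  assumes k: "(p + 1, k) \<in> maya_index A"
  shows "hom_coeff A f p k k' =
    (if (p, k') \<in> maya_index B then hom_coeff A f (p + 1) k k' else 0)"
proof (cases "p \<in> {1..n-1}")
  case True
  then have "p + 1 \<in> {2..n-1}"
    using maya_index_bounds[OF A k] by auto
  then have "f (p + 1 - 1) (down (maya A) (p + 1) (maya_w A (p + 1) k)) =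
      down (maya B) (p + 1) (f (p + 1) (maya_w A (p + 1) k))"
    using f maya_w_in_piece unfolding preproj_Hom_def by blast
  then show ?thesis
    unfolding hom_coeff_def by (simp only: maya_down_w[OF k]) (auto simp: maya_down_coord)
next
  case False
  then show ?thesis
    using maya_index_bounds[OF B, of p k'] hom_coeff_eq_0_right by auto
qed

text \<open>Before the last row of \<open>B\<close>, \<open>up\<close> sends basis vectors of
  \<open>N(B)\<close> to basis vectors, so an entry is carried along it unchanged.\<close>

lemma hom_coeff_up_add:
  assumes "(p, k) \<in> maya_index A" "(p, k') \<in> maya_index B" "k' + m \<le> card B"
  shows "hom_coeff A f (p + m) (k + m) (k' + m) = hom_coeff A f p k k'"
  using assms(3)
proof (induction m)
  case (Suc m)
  then have IH: "hom_coeff A f (p + m) (k + m) (k' + m) = hom_coeff A f p k k'"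
    by simp
  show ?case
  proof (cases "(p + m, k + m) \<in> maya_index A")
    case True
    then show ?thesis
      using hom_coeff_up[OF True, of "k' + m"] IH assms(2)
        maya_index_up_add[OF assms(2) Suc.prems] by (simp add: maya_index_iff)
  next
    case False
    \<comment> \<open>The path has passed row \<open>card A\<close> and never returns, so both
      entries are 0.\<close>
    then have "(p + Suc m, k + Suc m) \<notin> maya_index A"
      using maya_index_up_add[OF assms(1), of m] by (auto simp: maya_index_iff)
    with False IH show ?thesis
      by (metis hom_coeff_eq_0_left)
  qed
qed simp

text \<open>Lowering the degree within row \<open>k'\<close> stays in the diagram of
  \<open>B\<close> as long as \<open>k' \<le> q\<close>, and there \<open>down\<close> preserves the
  coordinate.\<close>

lemma hom_coeff_down_add:
  "(q + m, k) \<in> maya_index A \<Longrightarrow> (q + m, k') \<in> maya_index B \<Longrightarrow> k' \<le> q \<Longrightarrow>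
     hom_coeff A f q k k' = hom_coeff A f (q + m) k k'"
proof (induction m)
  case (Suc m)
  have "hom_coeff A f q k k' = hom_coeff A f (q + m) k k'"
  proof (cases "(q + m, k) \<in> maya_index A")
    case True
    then show ?thesis
      using Suc maya_index_down[of "q + Suc m" k' B "q + m"] by simp
  next
    case False
    \<comment> \<open>Here \<open>q + m < k\<close>, so row \<open>k\<close> of \<open>A\<close> has
      no box in degree \<open>q\<close> either.\<close>
    then have "(q, k) \<notin> maya_index A"
      using Suc.prems(1) by (auto simp: maya_index_iff)
    with False show ?thesis
      by (simp add: hom_coeff_eq_0_left)
  qed
  also have "\<dots> = hom_coeff A f (q + Suc m) k k'"
    using Suc.prems hom_coeff_down[of "q + m" k k'] maya_index_down[of "q + Suc m" k' B "q + m"]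
    by simp
  finally show ?case .
qed simp

text \<open>Go along \<open>up\<close> until row \<open>k'\<close> has become the last row of
  \<open>B\<close>, then along \<open>down\<close> to degree \<open>card B\<close>. Every entry is
  thus an entry into the corner.\<close>

lemma hom_coeff_eq_corner:
  assumes k: "(p, k) \<in> maya_index A" and k': "(p, k') \<in> maya_index B"
  shows "hom_coeff A f p k k' = hom_coeff A f (card B) (k + (card B - k')) (card B)"
proof -
  define m where "m = card B - k'"
  have m: "k' + m = card B" and le: "card B \<le> p + m"
    using k' by (auto simp: m_def maya_index_iff)
  have eq: "hom_coeff A f p k k' = hom_coeff A f (p + m) (k + m) (card B)"
    using hom_coeff_up_add[OF k k', of m] m by simp
  have "hom_coeff A f (p + m) (k + m) (card B) = hom_coeff A f (card B) (k + m) (card B)"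
  proof (cases "k + m \<le> card A")
    case True
    then have "(p + m, k + m) \<in> maya_index A"
      using k maya_index_up_add by blast
    moreover have "(p + m, card B) \<in> maya_index B"
      using maya_index_up_add[OF k', of m] m by simp
    ultimately show ?thesis
      using hom_coeff_down_add[of "card B" "p + m - card B" "k + m" "card B"] le by simp
  next
    case False
    then show ?thesis
      by (simp add: hom_coeff_eq_0_left maya_index_iff)
  qed
  then show ?thesis
    using eq by (simp add: m_def)
qed

text \<open>By \<open>hom_coeff_up\<close> the next entry is the previous one or 0, so a zero
  persists even where the path lies outside \<open>B\<close>; only the boxes of \<open>A\<close>
  have to exist. The next lemma is the same for \<open>down\<close>.\<close>

lemma hom_coeff_up_zero:
  assumes "(p, k) \<in> maya_index A" "k + m \<le> card A" "hom_coeff A f p k k' = 0"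
  shows "hom_coeff A f (p + m) (k + m) (k' + m) = 0"
  using assms(2)
proof (induction m)
  case (Suc m)
  then show ?case
    using hom_coeff_up[OF maya_index_up_add[OF assms(1)], of m "k' + m"] by simp
qed (use assms in simp)

lemma hom_coeff_down_zero:
  "(q + m, k) \<in> maya_index A \<Longrightarrow> k \<le> q \<Longrightarrow> hom_coeff A f (q + m) k k' = 0 \<Longrightarrow>
     hom_coeff A f q k k' = 0"
proof (induction m)
  case (Suc m)
  then show ?case
    using hom_coeff_down[of "q + m" k k'] maya_index_down[of "q + Suc m" k A "q + m"] by simp
qed simp

text \<open>Otherwise row \<open>r - l\<close> of \<open>A\<close> has a box just past the end of
  row \<open>card B - l\<close> of \<open>B\<close>. The entry there is 0, and carrying this zero
  \<open>l\<close> steps along \<open>up\<close> and then along \<open>down\<close> to degree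
  \<open>card B\<close> kills the corner entry.\<close>

lemma hom_coeff_corner_nonzero:
  assumes nz: "hom_coeff A f (card B) r (card B) \<noteq> 0" and l: "l \<le> r - 1"
  shows "nth_elem A (r - l) \<le> nth_elem B (card B - l)"
proof (rule ccontr)
  assume less: "\<not> ?thesis"
  have r: "(card B, r) \<in> maya_index A"
    using nz hom_coeff_eq_0_left by blast
  \<comment> \<open>The first degree past the end of row \<open>card B - l\<close> of
    \<open>B\<close>.\<close>
  define p where "p = nth_elem B (card B - l)"
  have bounds: "1 \<le> r" "r \<le> card A" "r \<le> card B"
    using r by (auto simp: maya_index_iff)
  then have p: "card B - l \<le> p"
    using nth_elem_ge[OF B, of "card B - l"] l by (simp add: p_def)
  have pk: "(p, r - l) \<in> maya_index A"
    using bounds l p less by (auto simp: maya_index_iff p_def)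
  have "(p, card B - l) \<notin> maya_index B"
    by (simp add: maya_index_iff p_def)
  then have "hom_coeff A f p (r - l) (card B - l) = 0"
    by (rule hom_coeff_eq_0_right)
  then have "hom_coeff A f (p + l) (r - l + l) (card B - l + l) = 0"
    using bounds l by (intro hom_coeff_up_zero[OF pk]) auto
  moreover have "(p + l, r) \<in> maya_index A"
    using maya_index_up_add[OF pk, of l] bounds l by simp
  ultimately have "hom_coeff A f (card B) r (card B) = 0"
    using hom_coeff_down_zero[of "card B" "p + l - card B" r "card B"] bounds l p by simp
  with nz show False ..
qed

end

section \<open>Translations as homomorphisms\<close>

text \<open>Row \<open>k - s\<close> moves to row \<open>k\<close>, and whatever falls outside
  \<open>B\<close> is dropped. Vectors outside the piece go to 0 by the convention of
  \<open>preproj_Hom\<close>; \<open>s < k\<close> keeps the subtraction exact and the source row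
  positive.\<close>

definition shift_hom ::
  "nat set \<Rightarrow> nat set \<Rightarrow> nat \<Rightarrow> nat \<Rightarrow> (nat \<times> nat \<Rightarrow> 'k::field) \<Rightarrow> (nat \<times> nat \<Rightarrow> 'k)"
where
  "shift_hom A B s p v = (\<lambda>(q, k).
     if v \<in> piece (maya A) p \<and> (q, k) \<in> maya_index B \<and> s < k then v (q, k - s) else 0)"

text \<open>Membership of \<open>(card B, r)\<close> packs the bounds on \<open>r\<close>: it says
  that \<open>N(A)\<close> has a basis vector for the translation to send to the corner.\<close>

definition maya_Hom_index :: "nat set \<Rightarrow> nat set \<Rightarrow> nat set" where
  "maya_Hom_index A B = {r. (card B, r) \<in> maya_index A \<and>
     (\<forall>l\<le>r - 1. nth_elem A (r - l) \<le> nth_elem B (card B - l))}"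

text \<open>With \<open>l = card B - k\<close> the condition on \<open>r\<close> says that row
  \<open>k - s\<close> of \<open>A\<close> ends no later than row \<open>k\<close> of
  \<open>B\<close>.\<close>

lemma maya_Hom_index_subset:
  assumes r: "r \<in> maya_Hom_index A B" and s: "s = card B - r"
    and k: "(p, k - s) \<in> maya_index A" "s < k" "k \<le> card B" and p: "k \<le> p"
  shows "(p, k) \<in> maya_index B"
proof -
  have rB: "r \<le> card B"
    using r by (auto simp: maya_Hom_index_def maya_index_iff)
  have "card B - k \<le> r - 1"
    using rB s k by auto
  then have "nth_elem A (r - (card B - k)) \<le> nth_elem B (card B - (card B - k))"
    using r unfolding maya_Hom_index_def by blast
  moreover have "r - (card B - k) = k - s" "card B - (card B - k) = k"
    using rB s k by auto
  ultimately have "nth_elem A (k - s) \<le> nth_elem B k"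
    by simp
  then show ?thesis
    using k p by (auto simp: maya_index_iff)
qed

text \<open>The two ways round a square can differ only where the target box lies in
  \<open>B\<close> but an intermediate box is missing from \<open>A\<close> or \<open>B\<close>; the
  condition on \<open>r\<close> excludes this.\<close>

lemma shift_hom_in_Hom:
  fixes A B :: "nat set"
  assumes A: "A \<subseteq> {1..n}" and r: "r \<in> maya_Hom_index A B"
  shows "shift_hom A B (card B - r) \<in>
    preproj_Hom n (maya A :: ('k::field, nat \<times> nat \<Rightarrow> 'k) preproj_rep) (maya B)"
proof -
  define s where "s = card B - r"
  let ?f = "shift_hom A B s :: nat \<Rightarrow> (nat \<times> nat \<Rightarrow> 'k) \<Rightarrow> _"
  let ?M = "maya A :: ('k, nat \<times> nat \<Rightarrow> 'k) preproj_rep"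
  have rA: "r \<le> card A" "r \<le> card B"
    using r by (auto simp: maya_Hom_index_def maya_index_iff)
  have up_in: "up ?M p v \<in> piece ?M (p + 1)" for p v
    by (auto simp: piece_maya_iff maya_up_coord split: if_splits)
  have down_in: "down ?M p v \<in> piece ?M (p - 1)" for p v
    by (auto simp: piece_maya_iff maya_down_coord split: if_splits)
  have lin: "linear_between fun_scal fun_scal (piece ?M p) (piece (maya B) p) (?f p)" for p
  proof -
    have "x + y \<in> piece ?M p" "fun_scal c x \<in> piece ?M p"
      if "x \<in> piece ?M p" "y \<in> piece ?M p" for x y c
      using that fun_vs.subspace_add[OF subspace_piece_maya]
        fun_vs.subspace_scale[OF subspace_piece_maya] by blast+
    moreover have "?f p x \<in> piece (maya B) p" if "x \<in> piece ?M p" for x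
      using that by (auto simp: piece_maya_iff shift_hom_def split: if_splits)
    ultimately show ?thesis
      unfolding linear_between_def by (auto simp: shift_hom_def fun_scal_def fun_eq_iff)
  qed
  have zero: "?f p v = 0" if "\<not> (p \<in> {1..n-1} \<and> v \<in> piece ?M p)" for p v
  proof (cases "v \<in> piece ?M p")
    case True
    \<comment> \<open>Degrees outside \<open>{1..n-1}\<close> carry no boxes of
      \<open>A\<close>.\<close>
    with that have "v (q, k) = 0" for q k
      using maya_index_bounds[OF A, of q k] by (auto simp: piece_maya_iff)
    then show ?thesis
      by (simp add: shift_hom_def fun_eq_iff)
  qed (simp add: shift_hom_def fun_eq_iff)
  have up: "?f (p + 1) (up ?M p v) (q, k) = up (maya B) p (?f p v) (q, k)"
    if v: "v \<in> piece ?M p" for p v q k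
  \<comment> \<open>Away from these coordinates both sides are 0; \<open>s + 1 < k\<close> says that
    row \<open>k - 1\<close> is the translate of a row with positive number.\<close>
  proof (cases "q = p + 1 \<and> (q, k) \<in> maya_index B \<and> s + 1 < k \<and> v (p, k - 1 - s) \<noteq> 0")
    case True
    then have kA: "(p, k - 1 - s) \<in> maya_index A"
      using v by (auto simp: piece_maya_iff)
    have kB: "k \<le> card B" "k - 1 \<le> p"
      using True by (auto simp: maya_index_iff)
    have "(p, k - 1) \<in> maya_index B"
      using True kA kB by (intro maya_Hom_index_subset[OF r s_def]) auto
    \<comment> \<open>From \<open>k \<le> card B\<close> follows
      \<open>k - s \<le> r \<le> card A\<close>, so \<open>up\<close> does not leave
      \<open>A\<close>.\<close>
    moreover have "k - 1 - s < card A" "k - 1 - s + 1 = k - s"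
      using True kB rA by (auto simp: s_def)
    then have "(p + 1, k - s) \<in> maya_index A"
      using maya_index_up[OF kA] by metis
    moreover have "k - s - 1 = k - 1 - s" "s < k" "s < k - 1" "2 \<le> k - s" "2 \<le> k"
      using True by auto
    ultimately show ?thesis
      using True v up_in[of p v] by (simp add: shift_hom_def maya_up_coord del: diff_diff_left)
  next
    case False
    then show ?thesis
      using v up_in by (auto simp: shift_hom_def maya_up_coord)
  qed
  have down: "?f (p - 1) (down ?M p v) (q, k) = down (maya B) p (?f p v) (q, k)"
    if v: "v \<in> piece ?M p" for p v q k
  proof (cases "q = p - 1 \<and> (q, k) \<in> maya_index B \<and> s < k \<and> v (p, k - s) \<noteq> 0")
    case True
    then have kA: "(p, k - s) \<in> maya_index A"
      using v by (auto simp: piece_maya_iff)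
    have kB: "k \<le> card B" "k \<le> p - 1"
      using True by (auto simp: maya_index_iff)
    have "(p, k) \<in> maya_index B"
      using True kA kB by (intro maya_Hom_index_subset[OF r s_def]) auto
    moreover have "(p - 1, k - s) \<in> maya_index A"
      using kA kB by (intro maya_index_down[OF kA]) auto
    ultimately show ?thesis
      using True v down_in by (auto simp: shift_hom_def maya_down_coord)
  next
    case False
    then show ?thesis
      using v down_in by (auto simp: shift_hom_def maya_down_coord)
  qed
  have "?f \<in> preproj_Hom n ?M (maya B)"
    unfolding preproj_Hom_def using lin zero up down by (auto simp: fun_eq_iff)
  then show ?thesis
    by (simp add: s_def)
qed

section \<open>The basis of translations and the dimension\<close>

text \<open>If the largest element were at most \<open>card B\<close>, then \<open>B\<close> would
  lie in \<open>{1..card B}\<close> and equal it by cardinality.\<close>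

lemma corner_in_maya_index:
  assumes "B \<subseteq> {1..n}" "B \<noteq> {1..card B}"
  shows "(card B, card B) \<in> maya_index B"
proof -
  have fin: "finite B"
    using assms(1) finite_subset by blast
  have pos: "1 \<le> card B"
    using assms(2) fin by (cases "card B") auto
  have "card B < nth_elem B (card B)"
  proof (rule ccontr)
    assume le: "\<not> ?thesis"
    have "B \<subseteq> {1..card B}"
    proof
      fix x assume x: "x \<in> B"
      then obtain m where m: "m < card B" "sorted_list_of_set B ! m = x"
        using fin by (metis in_set_conv_nth length_sorted_list_of_set set_sorted_list_of_set)
      then have "x = nth_elem B (m + 1)"
        by (simp add: nth_elem_def)
      then have "x \<le> nth_elem B (card B)"
        using nth_elem_less[of "m + 1" "card B" B] m(1) by (cases "m + 1 = card B") auto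
      then show "x \<in> {1..card B}"
        using le x assms(1) by auto
    qed
    then have "B = {1..card B}"
      by (intro card_subset_eq) auto
    with assms(2) show False ..
  qed
  with pos show ?thesis
    by (simp add: maya_index_iff)
qed

text \<open>Row \<open>t\<close> reaches the corner only under the shift \<open>card B - t\<close>,
  so the corner entries are dual to the translations.\<close>

lemma hom_coeff_shift_hom:
  assumes "(card B, card B) \<in> maya_index B" "(card B, t) \<in> maya_index A" "r \<in> maya_Hom_index A B"
  shows "hom_coeff A (shift_hom A B (card B - r)) (card B) t (card B) = (if r = t then 1 else 0)"
  using assms maya_w_in_piece
  by (auto simp: hom_coeff_def shift_hom_def maya_w_apply maya_Hom_index_def maya_index_iff)

lemma finite_maya_Hom_index: "finite (maya_Hom_index A B)"
  by (rule finite_subset[of _ "{1..card A}"]) (auto simp: maya_Hom_index_def maya_index_iff)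

text \<open>Both sides are compared at each coordinate: once all entries are corner entries, the
  substitution \<open>r = k + m\<close> turns the matrix product into the sum of translates.\<close>

lemma hom_eq_sum_shift_hom:
  fixes f :: "nat \<Rightarrow> (nat \<times> nat \<Rightarrow> 'k::field) \<Rightarrow> (nat \<times> nat \<Rightarrow> 'k)"
  assumes A: "A \<subseteq> {1..n}" and B: "B \<subseteq> {1..n}"
    and f: "f \<in> preproj_Hom n (maya A) (maya B)"
  shows "f = (\<Sum>r\<in>maya_Hom_index A B. Hom_scal (maya B)
    (hom_coeff A f (card B) r (card B)) (shift_hom A B (card B - r)))"
proof (intro ext)
  fix p v and x :: "nat \<times> nat"
  obtain q k' where x: "x = (q, k')"
    by (cases x)
  let ?c = "\<lambda>r. hom_coeff A f (card B) r (card B)" and ?R = "maya_Hom_index A B"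
  have rhs: "(\<Sum>r\<in>?R. Hom_scal (maya B) (?c r) (shift_hom A B (card B - r))) p v x =
      (\<Sum>r\<in>?R. ?c r * shift_hom A B (card B - r) p v x)"
    by (simp add: sum_fun_apply Hom_scal_def fun_scal_def)
  show "f p v x = (\<Sum>r\<in>?R. Hom_scal (maya B) (?c r) (shift_hom A B (card B - r))) p v x"
    unfolding rhs
  proof (cases "v \<in> piece (maya A) p \<and> q = p \<and> (p, k') \<in> maya_index B")
    case False
    have "f p v x = 0"
    proof (cases "v \<in> piece (maya A) p")
      case True
      with False hom_in_piece[OF A B f True] show ?thesis
        by (auto simp: piece_maya_iff x)
    next
      case False
      then have "f p v = 0"
        using f unfolding preproj_Hom_def by blast
      then show ?thesis
        by simp
    qed
    moreover have "shift_hom A B s p v x = 0" for s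
      using False by (auto simp: shift_hom_def piece_maya_iff x)
    ultimately show "f p v x = (\<Sum>r\<in>?R. ?c r * shift_hom A B (card B - r) p v x)"
      by simp
  next
    case True
    then have v: "v \<in> piece (maya A) p" and q: "q = p" and k': "(p, k') \<in> maya_index B"
      by auto
    \<comment> \<open>Row \<open>k'\<close> lies \<open>m\<close> rows before the last row of
      \<open>B\<close>, so by \<open>hom_coeff_eq_corner\<close> the entry from row \<open>k\<close>
      is the corner entry of row \<open>k + m\<close>.\<close>
    define m where "m = card B - k'"
    have km: "k' + m = card B"
      using k' by (auto simp: m_def maya_index_iff)
    have c0: "?c r = 0" if "r \<notin> ?R" for r
      using that hom_coeff_eq_0_left[OF A B f] hom_coeff_corner_nonzero[OF A B f, of r]
      by (auto simp: maya_Hom_index_def)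
    \<comment> \<open>The shift taking row \<open>r\<close> to the last row takes row
      \<open>r - m\<close> to row \<open>k'\<close>.\<close>
    have sh: "shift_hom A B (card B - r) p v x = (if m < r then v (p, r - m) else 0)"
      if "r \<in> ?R" for r
    proof -
      have "r \<le> card B"
        using that by (auto simp: maya_Hom_index_def maya_index_iff)
      then have "card B - r < k' \<longleftrightarrow> m < r" "k' - (card B - r) = r - m"
        using km by auto
      then show ?thesis
        using v k' by (simp add: shift_hom_def x q)
    qed
    have "f p v x = (\<Sum>k\<in>{1..card A}. v (p, k) * hom_coeff A f p k k')"
      using hom_eq_sum[OF A B f v] by (simp add: x q)
    also have "\<dots> = (\<Sum>k\<in>{1..card A}. v (p, k) * ?c (k + m))"
    proof (intro sum.cong refl)
      fix k
      show "v (p, k) * hom_coeff A f p k k' = v (p, k) * ?c (k + m)"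
      proof (cases "v (p, k) = 0")
        case False
        then have "(p, k) \<in> maya_index A"
          using v unfolding piece_maya_iff by blast
        then show ?thesis
          by (simp only: hom_coeff_eq_corner[OF A B f _ k'] m_def)
      qed simp
    qed
    also have "\<dots> = (\<Sum>r\<in>(\<lambda>k. k + m) ` {1..card A}. v (p, r - m) * ?c r)"
      by (subst sum.reindex) (auto simp: inj_on_def)
    \<comment> \<open>The indices dropped have \<open>?c r = 0\<close>. Those kept satisfy
      \<open>r \<le> card A\<close>, so \<open>r - m\<close> is a row number of
      \<open>A\<close>.\<close>
    also have "\<dots> = (\<Sum>r\<in>{r\<in>?R. m < r}. v (p, r - m) * ?c r)"
    proof (rule sum.mono_neutral_right)
      have "r \<in> (\<lambda>k. k + m) ` {1..card A}" if "r \<in> ?R" "m < r" for r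
        using that by (intro image_eqI[of _ _ "r - m"]) (auto simp: maya_Hom_index_def maya_index_iff)
      then show "{r\<in>?R. m < r} \<subseteq> (\<lambda>k. k + m) ` {1..card A}"
        by blast
      show "\<forall>r\<in>(\<lambda>k. k + m) ` {1..card A} - {r\<in>?R. m < r}. v (p, r - m) * ?c r = 0"
        using c0 by auto
    qed simp
    also have "\<dots> = (\<Sum>r\<in>?R. if m < r then v (p, r - m) * ?c r else 0)"
      using finite_maya_Hom_index by (rule sum.inter_filter)
    also have "\<dots> = (\<Sum>r\<in>?R. ?c r * shift_hom A B (card B - r) p v x)"
      by (intro sum.cong) (auto simp: sh)
    finally show "f p v x = (\<Sum>r\<in>?R. ?c r * shift_hom A B (card B - r) p v x)" .
  qed
qed

text \<open>The translations are a basis: they span by \<open>hom_eq_sum_shift_hom\<close>, and the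
  corner entries separate them.\<close>

lemma dim_preproj_Hom_maya:
  fixes A B :: "nat set"
  assumes A: "A \<subseteq> {1..n}" and B: "B \<subseteq> {1..n}" "B \<noteq> {1..card B}"
  shows "vector_space.dim (Hom_scal (maya B))
           (preproj_Hom n (maya A :: ('k::field, nat \<times> nat \<Rightarrow> 'k) preproj_rep) (maya B)) =
         card (maya_Hom_index A B)"
proof -
  let ?V = "preproj_Hom n (maya A :: ('k, nat \<times> nat \<Rightarrow> 'k) preproj_rep) (maya B)"
  let ?R = "maya_Hom_index A B"
  let ?g = "\<lambda>r. shift_hom A B (card B - r) :: nat \<Rightarrow> (nat \<times> nat \<Rightarrow> 'k) \<Rightarrow> (nat \<times> nat \<Rightarrow> 'k)"
  interpret H: vector_space "Hom_scal (maya B :: ('k, nat \<times> nat \<Rightarrow> 'k) preproj_rep)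
      :: 'k \<Rightarrow> (nat \<Rightarrow> (nat \<times> nat \<Rightarrow> 'k) \<Rightarrow> _) \<Rightarrow> _"
    by (rule vector_space_Hom_scal) (simp add: vector_space_fun_scal)
  have coeff: "hom_coeff A (?g r) (card B) t (card B) = (if r = t then 1 else 0)"
    if "r \<in> ?R" "t \<in> ?R" for r t
    using that(2) hom_coeff_shift_hom[OF corner_in_maya_index[OF B] _ that(1), of t]
    by (simp add: maya_Hom_index_def[of A B])
  have inj: "inj_on ?g ?R"
  proof (rule inj_onI)
    fix r t assume "r \<in> ?R" "t \<in> ?R" "?g r = ?g t"
    then show "r = t"
      using coeff[of r t] coeff[of t t] by (auto split: if_splits)
  qed
  \<comment> \<open>The corner entry of row \<open>t\<close> is a linear functional that kills every
    other translation, hence their span, but is 1 on \<open>?g t\<close>.\<close>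
  have "?g t \<notin> H.span (?g ` ?R - {?g t})" if t: "t \<in> ?R" for t
  proof
    assume "?g t \<in> H.span (?g ` ?R - {?g t})"
    then have "hom_coeff A (?g t) (card B) t (card B) = 0"
    proof (induction rule: H.span_induct_alt)
      case base
      then show ?case by (simp add: hom_coeff_def)
    next
      case (step c x y)
      then obtain r where "r \<in> ?R" "x = ?g r" "r \<noteq> t"
        by blast
      then have "hom_coeff A x (card B) t (card B) = 0"
        using coeff[of r t] t by simp
      with step show ?case
        by (simp add: hom_coeff_def Hom_scal_def fun_scal_def)
    qed
    then show False
      using coeff[OF t t] by simp
  qed
  then have "H.independent (?g ` ?R)"
    unfolding H.dependent_def by blast
  moreover have "?g ` ?R \<subseteq> ?V"
    using shift_hom_in_Hom[OF A] by blast
  moreover have "?V \<subseteq> H.span (?g ` ?R)"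
  proof
    fix f assume "f \<in> ?V"
    then have "f = (\<Sum>r\<in>?R. Hom_scal (maya B) (hom_coeff A f (card B) r (card B)) (?g r))"
      by (rule hom_eq_sum_shift_hom[OF A B(1)])
    also have "\<dots> \<in> H.span (?g ` ?R)"
      by (intro H.span_sum H.span_scale H.span_base) blast
    finally show "f \<in> H.span (?g ` ?R)" .
  qed
  ultimately show ?thesis
    using H.dim_unique[of "?g ` ?R" ?V] card_image[OF inj] by blast
qed

theorem theorem3p5:
  fixes n i j :: nat and A B :: "nat set"
  assumes "n \<ge> 2"
    and "A \<subset> {1..n}" and "card A = i" and "A \<noteq> {1..i}"
    and "B \<subset> {1..n}" and "card B = j" and "B \<noteq> {1..j}"
  shows "vector_space.dim (Hom_scal (maya B))
           (preproj_Hom n (maya A :: ('k::field, nat \<times> nat \<Rightarrow> 'k) preproj_rep) (maya B)) =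
         card {r \<in> {1..i}. r \<le> j \<and> j < nth_elem A r \<and>
           (\<forall>l\<in>{0..r-1}. nth_elem A (r - l) \<le> nth_elem B (j - l))}"
proof -
  have "{r \<in> {1..i}. r \<le> j \<and> j < nth_elem A r \<and>
      (\<forall>l\<in>{0..r-1}. nth_elem A (r - l) \<le> nth_elem B (j - l))} = maya_Hom_index A B"
    using assms by (auto simp: maya_Hom_index_def maya_index_iff)
  then show ?thesis
    using dim_preproj_Hom_maya[of A n B, where 'k = 'k] assms by auto
qed

end
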